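(* Let $f\in\mathbb{F}[x_1,\dots,x_n]$ be computed by a read-$k$ oblivious ABP of width $w$. Then there exist pairwise disjoint sets $U\sqcup V\sqcup W=[n]$ such that $|U|,|V|\ge n/k^{O(k)}$ (absolute implied constant), $|W|\le n/10$, and $\operatorname{evalDim}_{U,V;W}(f)\le w^{2k}$.
   Context: An algebraic branching program (ABP) over $\mathbb{F}$ is a directed acyclic graph whose vertices are partitioned into layers $0,\dots,L$, with a single source in layer $0$ and a single sink in layer $L$, edges only from layer $\ell-1$ to layer $\ell$, each edge labeled by a polynomial; it computes the sum over all source–sink paths of the product of edge labels. Its width is the maximum number of vertices in a layer. It is oblivious if in each layer all edge labels are univariate polynomials in one common variable, and read-$k$ if each variable is read in at most $k$ layers. For $S\subseteq[n]$ write $\mathbf{x}_S=\{x_i:i\in S\}$ and, for $\mathbf{a}\in\mathbb{F}^{|S|}$, $f|_{\mathbf{x}_S=\mathbf{a}}$ for the polynomial obtained by substituting $\mathbf{a}$ for the variables of $\mathbf{x}_S$. For a partition $[n]=S\sqcup T\sqcup R$, $\operatorname{evalDim}_{S,T;R}(f)$ is the dimension, over the field of rational functions $\mathbb{F}(\mathbf{x}_R)$, of the span of $\{f|_{\mathbf{x}_S=\mathbf{a}}:\mathbf{a}\in\mathbb{F}^{|S|}\}$ (i.e. the variables $\mathbf{x}_R$ are treated as field constants).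
   Formalization: The case n = 1 is excluded (two disjoint nonempty subsets of a one-element set cannot exist), k ≥ 1 is assumed, and k^{O(k)} is read as max(2,k)^{100k}, since for k = 1 the literal bound would demand |U|,|V| ≥ n. *)

theory Defs
  imports
    "HOL-Library.Poly_Mapping"
    "HOL-Library.Extended_Nat"
    "HOL-Computational_Algebra.Fraction_Field"
    "HOL-Algebra.Embedded_Algebras"
    "HOL-Algebra.Algebraic_Closure_Type"
    "Graph_Theory.Arc_Walk"
begin

section \<open>Polynomials\<close>

text \<open>Polynomials in the variables \<open>x\<^sub>i\<close>, \<open>i :: nat\<close>: finitely supported maps from exponent
  vectors to coefficients, with the convolution product of \<^theory>\<open>HOL-Library.Poly_Mapping\<close>.\<close>

type_synonym 'a mpoly = "(nat \<Rightarrow>\<^sub>0 nat) \<Rightarrow>\<^sub>0 'a"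

definition Const :: "'a::zero \<Rightarrow> 'a mpoly" where
  "Const c = Poly_Mapping.single 0 c"

definition Var :: "nat \<Rightarrow> 'a::zero_neq_one mpoly" where
  "Var i = Poly_Mapping.single (Poly_Mapping.single i 1) 1"

definition vars :: "'a::zero mpoly \<Rightarrow> nat set" where
  "vars p = (\<Union>m\<in>Poly_Mapping.keys p. Poly_Mapping.keys m)"

text \<open>\<open>f|\<^bsub>x\<^sub>S = a\<^esub>\<close>; only the values of \<open>a\<close> on \<open>S\<close> matter.\<close>

definition subst_on :: "nat set \<Rightarrow> (nat \<Rightarrow> 'a) \<Rightarrow> 'a::comm_ring_1 mpoly \<Rightarrow> 'a mpoly" where
  "subst_on S a f = (\<Sum>m\<in>Poly_Mapping.keys f. Const (Poly_Mapping.lookup f m) *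
     (\<Prod>i\<in>Poly_Mapping.keys m. (if i \<in> S then Const (a i) else Var i) ^ Poly_Mapping.lookup m i))"


section \<open>Evaluation dimension\<close>

text \<open>The subfield \<open>\<bbbF>(x\<^sub>R)\<close> of the field of rational functions in all the variables.\<close>

definition rat_funs :: "nat set \<Rightarrow> 'a::field mpoly fract set" where
  "rat_funs R = {Fract p q | p q. vars p \<subseteq> R \<and> vars q \<subseteq> R \<and> q \<noteq> 0}"

text \<open>The linear span of a possibly infinite set, as the union of the spans of its finite lists.\<close>

definition span_over :: "'b::field set \<Rightarrow> 'b set \<Rightarrow> 'b set" where
  "span_over K A = (\<Union>us\<in>lists A. ring.Span ring_of_type_algebra K us)"

text \<open>The guard is needed because \<open>ring.dim\<close> is unspecified on infinite-dimensional spaces.\<close>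

definition dim_over :: "'b::field set \<Rightarrow> 'b set \<Rightarrow> enat" where
  "dim_over K E =
     (if ring.finite_dimension ring_of_type_algebra K E
      then enat (ring.dim ring_of_type_algebra K E) else \<infinity>)"

text \<open>For a partition \<open>S \<squnion> T \<squnion> R\<close> of the variables of \<open>f\<close>. The polynomials \<open>f|\<^bsub>x\<^sub>S = a\<^esub>\<close> lie in
  \<open>\<bbbF>(x\<^sub>R)[x\<^sub>T]\<close>, which is regarded as an \<open>\<bbbF>(x\<^sub>R)\<close>-subspace of the field of rational functions
  in all the variables. The set \<open>T\<close> is determined by \<open>S\<close> and \<open>R\<close> and is an argument only to follow
  the customary notation.\<close>

definition eval_dim :: "nat set \<Rightarrow> nat set \<Rightarrow> nat set \<Rightarrow> 'a::field mpoly \<Rightarrow> enat" where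
  "eval_dim S T R f =
     dim_over (rat_funs R) (span_over (rat_funs R) {Fract (subst_on S a f) 1 | a. True})"


section \<open>Algebraic branching programs\<close>

record (overloaded) ('v, 'e, 'a) abp =
  graph :: "('v, 'e) pre_digraph"
  depth :: nat
  layer :: "'v \<Rightarrow> nat"
  source :: 'v
  sink :: 'v
  label :: "'e \<Rightarrow> 'a mpoly"

definition layer_verts :: "('v, 'e, 'a) abp \<Rightarrow> nat \<Rightarrow> 'v set" where
  "layer_verts B l = {v \<in> verts (graph B). layer B v = l}"

text \<open>The edges from layer \<open>l - 1\<close> to layer \<open>l\<close>.\<close>

definition layer_arcs :: "('v, 'e, 'a) abp \<Rightarrow> nat \<Rightarrow> 'e set" where
  "layer_arcs B l = {e \<in> arcs (graph B). layer B (head (graph B) e) = l}"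

text \<open>An ABP over \<open>\<bbbF>[x\<^sub>1, \<dots>, x\<^sub>n]\<close>. Acyclicity is a consequence of the condition on the layers of
  the edges. Parallel edges are allowed.\<close>

definition is_abp :: "nat \<Rightarrow> ('v, 'e, 'a::field) abp \<Rightarrow> bool" where
  "is_abp n B \<longleftrightarrow>
     fin_digraph (graph B) \<and>
     (\<forall>v\<in>verts (graph B). layer B v \<le> depth B) \<and>
     layer_verts B 0 = {source B} \<and>
     layer_verts B (depth B) = {sink B} \<and>
     (\<forall>e\<in>arcs (graph B).
        layer B (head (graph B) e) = Suc (layer B (tail (graph B) e))) \<and>
     (\<forall>e\<in>arcs (graph B). vars (label B e) \<subseteq> {1..n})"

definition abp_poly :: "('v, 'e, 'a::field) abp \<Rightarrow> 'a mpoly" where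
  "abp_poly B =
     (\<Sum>p\<in>{p. pre_digraph.apath (graph B) (source B) p (sink B)}. \<Prod>e\<leftarrow>p. label B e)"

definition width :: "('v, 'e, 'a) abp \<Rightarrow> nat" where
  "width B = Max ((\<lambda>l. card (layer_verts B l)) ` {0..depth B})"

definition oblivious :: "('v, 'e, 'a::field) abp \<Rightarrow> bool" where
  "oblivious B \<longleftrightarrow>
     (\<forall>l\<in>{1..depth B}. \<exists>i. \<forall>e\<in>layer_arcs B l. vars (label B e) \<subseteq> {i})"

text \<open>A layer reads \<open>x\<^sub>i\<close> if \<open>x\<^sub>i\<close> occurs in the label of one of its edges; layers whose labels are
  all constants read nothing.\<close>

definition read_at_most :: "nat \<Rightarrow> ('v, 'e, 'a::field) abp \<Rightarrow> bool" where
  "read_at_most k B \<longleftrightarrow>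
     (\<forall>i. card {l \<in> {1..depth B}. \<exists>e\<in>layer_arcs B l. i \<in> vars (label B e)} \<le> k)"

end

theory Submission
  imports Defs
begin

text \<open>Cut the layers into \<open>20 k\<^sup>2\<close> blocks of at most \<open>n / (10 k)\<close> reading layers each. Every
  variable is read in at most \<open>k\<close> blocks, so many variables are read only inside one common set
  \<open>T\<close> of \<open>k\<close> blocks. Some of these variables form \<open>U\<close>, the other variables read in \<open>T\<close> form \<open>W\<close>,
  and the rest form \<open>V\<close>: inside \<open>T\<close> no variable of \<open>V\<close> is read, outside \<open>T\<close> none of \<open>U\<close>. A path
  switches between the two phases at most \<open>2 k\<close> times, and fixing its vertices at the switches
  writes \<open>f\<close> as a sum of at most \<open>w ^ (2 * k)\<close> products \<open>g h\<close> with \<open>g\<close> in \<open>x\<^sub>U, x\<^sub>W\<close> and \<open>h\<close> in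
  \<open>x\<^sub>V, x\<^sub>W\<close>; after substituting for \<open>x\<^sub>U\<close> everything lies in the span of the \<open>h\<close>. For \<open>n < 10 k\<close>
  the blocks would be empty; there \<open>U = {1}\<close>, \<open>W = {}\<close>, and the layers reading \<open>x\<^sub>1\<close> serve as
  \<open>T\<close>.\<close>

section \<open>Polynomials and substitution\<close>

lemma vars_zero [simp]: "vars 0 = {}"
  by (simp add: vars_def)

lemma vars_one [simp]: "vars (1 :: 'a::zero_neq_one mpoly) = {}"
  by (simp add: vars_def)

lemma vars_Const [simp]: "vars (Const c) = {}"
  by (simp add: vars_def Const_def)

lemma vars_Var: "vars (Var i :: 'a::zero_neq_one mpoly) \<subseteq> {i}"
  by (simp add: vars_def Var_def)

lemma vars_uminus [simp]: "vars (- p) = vars (p :: 'a::ab_group_add mpoly)"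
  by (simp add: vars_def in_keys_iff)

lemma vars_add_le:
  fixes p q :: "'a::comm_monoid_add mpoly"
  assumes "vars p \<subseteq> S" "vars q \<subseteq> S"
  shows "vars (p + q) \<subseteq> S"
  using assms keys_add[of p q] unfolding vars_def by blast

lemma vars_mult_le:
  fixes p q :: "'a::comm_semiring_1 mpoly"
  assumes "vars p \<subseteq> S" "vars q \<subseteq> S"
  shows "vars (p * q) \<subseteq> S"
proof
  fix i assume "i \<in> vars (p * q)"
  then obtain m where m: "m \<in> Poly_Mapping.keys (p * q)" "i \<in> Poly_Mapping.keys m"
    by (auto simp: vars_def)
  then obtain a b where "m = a + b" "a \<in> Poly_Mapping.keys p" "b \<in> Poly_Mapping.keys q"
    using keys_mult[of p q] by blast
  then show "i \<in> S"
    using m(2) keys_add[of a b] assms unfolding vars_def by blast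
qed

lemma vars_sum_le:
  fixes p :: "'b \<Rightarrow> 'a::comm_monoid_add mpoly"
  shows "(\<And>i. i \<in> A \<Longrightarrow> vars (p i) \<subseteq> S) \<Longrightarrow> vars (\<Sum>i\<in>A. p i) \<subseteq> S"
  by (induction A rule: infinite_finite_induct) (auto simp: vars_add_le)

lemma vars_prod_le:
  fixes p :: "'b \<Rightarrow> 'a::comm_semiring_1 mpoly"
  shows "(\<And>i. i \<in> A \<Longrightarrow> vars (p i) \<subseteq> S) \<Longrightarrow> vars (\<Prod>i\<in>A. p i) \<subseteq> S"
  by (induction A rule: infinite_finite_induct) (auto simp: vars_mult_le)

lemma vars_power_le:
  fixes p :: "'a::comm_semiring_1 mpoly"
  shows "vars p \<subseteq> S \<Longrightarrow> vars (p ^ n) \<subseteq> S"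
  by (induction n) (auto simp: vars_mult_le)

section \<open>Substitution as a ring homomorphism\<close>

lemma Const_zero [simp]: "Const 0 = 0"
  by (simp add: Const_def)

lemma Const_one [simp]: "Const 1 = 1"
  by (simp add: Const_def)

lemma Const_add: "Const (a + b) = Const a + Const b"
  by (simp add: Const_def single_add)

lemma Const_mult: "Const (a * b) = Const a * (Const b :: 'a::comm_semiring_1 mpoly)"
  by (simp add: Const_def mult_single)

text \<open>The inner product of \<open>subst_on\<close>, isolated so that multiplicativity can
  first be shown for monomials.\<close>

definition subst_monom :: "nat set \<Rightarrow> (nat \<Rightarrow> 'a) \<Rightarrow> (nat \<Rightarrow>\<^sub>0 nat) \<Rightarrow> 'a::comm_ring_1 mpoly" where
  "subst_monom S a m = (\<Prod>i\<in>Poly_Mapping.keys m.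
     (if i \<in> S then Const (a i) else Var i) ^ Poly_Mapping.lookup m i)"

text \<open>Indices outside the support contribute power 0; this lets two monomials share one index
  set.\<close>

lemma subst_monom_superset:
  assumes "finite I" "Poly_Mapping.keys m \<subseteq> I"
  shows "subst_monom S a m =
    (\<Prod>i\<in>I. (if i \<in> S then Const (a i) else Var i) ^ Poly_Mapping.lookup m i)"
  unfolding subst_monom_def using assms
  by (intro prod.mono_neutral_left) (auto simp: in_keys_iff)

lemma subst_monom_add: "subst_monom S a (m + m') = subst_monom S a m * subst_monom S a m'"
proof -
  let ?I = "Poly_Mapping.keys m \<union> Poly_Mapping.keys m'"
  have "subst_monom S a (m + m') =
      (\<Prod>i\<in>?I. (if i \<in> S then Const (a i) else Var i) ^ Poly_Mapping.lookup (m + m') i)"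
    using keys_add[of m m'] by (intro subst_monom_superset) auto
  also have "\<dots> = subst_monom S a m * subst_monom S a m'"
    by (simp add: subst_monom_superset[of ?I] lookup_add power_add prod.distrib)
  finally show ?thesis .
qed

lemma subst_on_superset:
  assumes "finite M" "Poly_Mapping.keys f \<subseteq> M"
  shows "subst_on S a f = (\<Sum>m\<in>M. Const (Poly_Mapping.lookup f m) * subst_monom S a m)"
  unfolding subst_on_def subst_monom_def[symmetric] using assms
  by (intro sum.mono_neutral_left) (auto simp: in_keys_iff)

lemma subst_on_add: "subst_on S a (f + g) = subst_on S a f + subst_on S a g"
proof -
  let ?M = "Poly_Mapping.keys f \<union> Poly_Mapping.keys g"
  have "subst_on S a (f + g) =
      (\<Sum>m\<in>?M. Const (Poly_Mapping.lookup (f + g) m) * subst_monom S a m)"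
    using keys_add[of f g] by (intro subst_on_superset) auto
  also have "\<dots> = subst_on S a f + subst_on S a g"
    by (simp add: subst_on_superset[of ?M] lookup_add Const_add algebra_simps sum.distrib)
  finally show ?thesis .
qed

lemma subst_on_zero [simp]: "subst_on S a 0 = 0"
  by (simp add: subst_on_def)

lemma subst_on_sum: "subst_on S a (\<Sum>i\<in>A. f i) = (\<Sum>i\<in>A. subst_on S a (f i))"
  by (induction A rule: infinite_finite_induct) (auto simp: subst_on_add)

lemma subst_on_single: "subst_on S a (Poly_Mapping.single m c) = Const c * subst_monom S a m"
  by (subst subst_on_superset[of "{m}"]) auto

lemma sum_single_keys:
  "(\<Sum>m\<in>Poly_Mapping.keys f. Poly_Mapping.single m (Poly_Mapping.lookup f m)) = f"
proof (rule poly_mapping_eqI)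
  fix m
  show "Poly_Mapping.lookup
      (\<Sum>m\<in>Poly_Mapping.keys f. Poly_Mapping.single m (Poly_Mapping.lookup f m)) m =
    Poly_Mapping.lookup f m"
    by (simp add: lookup_sum lookup_single when_def in_keys_iff)
qed

text \<open>Expanding both factors into monomials reduces the claim to
  \<open>subst_monom_add\<close>.\<close>

lemma subst_on_mult: "subst_on S a (f * g) = subst_on S a f * subst_on S a g"
proof -
  let ?s = "\<lambda>f m. Poly_Mapping.single m (Poly_Mapping.lookup f m)"
  have "f * g = (\<Sum>m\<in>Poly_Mapping.keys f. ?s f m) * (\<Sum>m\<in>Poly_Mapping.keys g. ?s g m)"
    by (simp add: sum_single_keys)
  also have "\<dots> = (\<Sum>m\<in>Poly_Mapping.keys f. \<Sum>m'\<in>Poly_Mapping.keys g. ?s f m * ?s g m')"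
    by (rule sum_product)
  finally have "f * g = \<dots>" .
  then have "subst_on S a (f * g) = (\<Sum>m\<in>Poly_Mapping.keys f. \<Sum>m'\<in>Poly_Mapping.keys g.
      subst_on S a (?s f m) * subst_on S a (?s g m'))"
    by (simp add: subst_on_sum subst_on_single mult_single subst_monom_add Const_mult algebra_simps)
  also have "\<dots> = subst_on S a f * subst_on S a g"
    by (simp add: sum_product[symmetric] subst_on_sum[symmetric] sum_single_keys)
  finally show ?thesis .
qed

lemma Var_power: "Var i ^ n = (Poly_Mapping.single (Poly_Mapping.single i n) 1 :: 'a::comm_ring_1 mpoly)"
  by (induction n) (auto simp: Var_def mult_single single_add[symmetric])

lemma prod_single_one:
  "(\<Prod>i\<in>I. Poly_Mapping.single (x i) 1) =
    (Poly_Mapping.single (\<Sum>i\<in>I. x i) 1 :: 'a::comm_ring_1 mpoly)"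
  by (induction I rule: infinite_finite_induct) (auto simp: mult_single)

lemma subst_monom_disjoint:
  assumes "Poly_Mapping.keys m \<inter> S = {}"
  shows "subst_monom S a m = Poly_Mapping.single m 1"
proof -
  have "subst_monom S a m = (\<Prod>i\<in>Poly_Mapping.keys m.
      Poly_Mapping.single (Poly_Mapping.single i (Poly_Mapping.lookup m i)) 1)"
    unfolding subst_monom_def using assms by (intro prod.cong) (auto simp: Var_power)
  then show ?thesis
    by (simp add: prod_single_one sum_single_keys)
qed

lemma subst_on_disjoint:
  assumes "vars f \<inter> S = {}"
  shows "subst_on S a f = f"
proof -
  have "Const (Poly_Mapping.lookup f m) * subst_monom S a m =
      Poly_Mapping.single m (Poly_Mapping.lookup f m)" if "m \<in> Poly_Mapping.keys f" for m
  proof -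
    have "Poly_Mapping.keys m \<inter> S = {}"
      using assms that by (auto simp: vars_def)
    then show ?thesis
      by (simp add: subst_monom_disjoint Const_def mult_single)
  qed
  then show ?thesis
    by (simp add: subst_on_superset[of "Poly_Mapping.keys f"] sum_single_keys cong: sum.cong)
qed

lemma vars_subst_on:
  fixes f :: "'a::comm_ring_1 mpoly"
  shows "vars (subst_on S a f) \<subseteq> vars f - S"
proof -
  have "vars ((if i \<in> S then Const (a i) else Var i) ^ Poly_Mapping.lookup m i) \<subseteq> vars f - S"
    if "m \<in> Poly_Mapping.keys f" "i \<in> Poly_Mapping.keys m" for m i
  proof (cases "i \<in> S")
    case True
    then show ?thesis by (simp add: vars_power_le)
  next
    case False
    then have "{i} \<subseteq> vars f - S"
      using that by (auto simp: vars_def)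
    with False show ?thesis
      by (simp only: if_False) (intro vars_power_le order_trans[OF vars_Var])
  qed
  then show ?thesis
    unfolding subst_on_def by (intro vars_sum_le vars_mult_le vars_prod_le) auto
qed

section \<open>Spans over a subfield of a field type\<close>

text \<open>These rules link type class arithmetic to the record-based ring in which
  \<open>Span\<close> and \<open>dim\<close> are defined.\<close>

lemma ring_of_type_algebra_simps [simp]:
  "carrier ring_of_type_algebra = UNIV"
  "(\<otimes>\<^bsub>ring_of_type_algebra\<^esub>) = (*)"
  "(\<oplus>\<^bsub>ring_of_type_algebra\<^esub>) = (+)"
  "\<zero>\<^bsub>ring_of_type_algebra\<^esub> = 0"
  "\<one>\<^bsub>ring_of_type_algebra\<^esub> = 1"
  by (simp_all add: ring_of_type_algebra_def)

lemma a_inv_ring_of_type_algebra: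
  "a_inv ring_of_type_algebra (x :: 'b::field) = - x"
proof -
  interpret field "ring_of_type_algebra :: 'b ring"
    by (rule field_from_type_algebra)
  show ?thesis
    by (rule sym, rule sum_zero_eq_neg) auto
qed

lemma m_inv_ring_of_type_algebra:
  assumes "(x :: 'b::field) \<noteq> 0"
  shows "m_inv ring_of_type_algebra x = inverse x"
proof -
  interpret field "ring_of_type_algebra :: 'b ring"
    by (rule field_from_type_algebra)
  show ?thesis
    using assms by (intro comm_inv_char) auto
qed

lemma subfield_from_type_algebra:
  fixes K :: "'b::field set"
  assumes "1 \<in> K" "\<And>x. x \<in> K \<Longrightarrow> - x \<in> K" "\<And>x y. x \<in> K \<Longrightarrow> y \<in> K \<Longrightarrow> x + y \<in> K"
    "\<And>x y. x \<in> K \<Longrightarrow> y \<in> K \<Longrightarrow> x * y \<in> K" "\<And>x. x \<in> K \<Longrightarrow> x \<noteq> 0 \<Longrightarrow> inverse x \<in> K"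
  shows "subfield K ring_of_type_algebra"
proof -
  interpret field "ring_of_type_algebra :: 'b ring"
    by (rule field_from_type_algebra)
  show ?thesis
    by (intro subfieldI' subringI)
      (use assms in \<open>auto simp: a_inv_ring_of_type_algebra m_inv_ring_of_type_algebra\<close>)
qed

lemma subfield_rat_funs: "subfield (rat_funs R :: 'a::field mpoly fract set) ring_of_type_algebra"
proof (rule subfield_from_type_algebra)
  show "1 \<in> (rat_funs R :: 'a mpoly fract set)"
    unfolding rat_funs_def One_fract_def
    by (intro CollectI exI[of _ 1]) auto
next
  fix x :: "'a mpoly fract" assume "x \<in> rat_funs R"
  then obtain p q where "x = Fract p q" "vars p \<subseteq> R" "vars q \<subseteq> R" "q \<noteq> 0"
    by (auto simp: rat_funs_def)
  then show "- x \<in> rat_funs R"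
    unfolding rat_funs_def by (intro CollectI exI[of _ "- p"] exI[of _ q]) auto
next
  fix x y :: "'a mpoly fract" assume "x \<in> rat_funs R" "y \<in> rat_funs R"
  then obtain p q p' q' where *: "x = Fract p q" "vars p \<subseteq> R" "vars q \<subseteq> R" "q \<noteq> 0"
    "y = Fract p' q'" "vars p' \<subseteq> R" "vars q' \<subseteq> R" "q' \<noteq> 0"
    by (auto simp: rat_funs_def)
  then show "x + y \<in> rat_funs R"
    unfolding rat_funs_def
    by (intro CollectI exI[of _ "p * q' + p' * q"] exI[of _ "q * q'"])
      (simp add: vars_add_le vars_mult_le)
  from * show "x * y \<in> rat_funs R"
    unfolding rat_funs_def
    by (intro CollectI exI[of _ "p * p'"] exI[of _ "q * q'"])
      (simp add: vars_mult_le)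
next
  fix x :: "'a mpoly fract" assume "x \<in> rat_funs R" "x \<noteq> 0"
  then obtain p q where *: "x = Fract p q" "vars p \<subseteq> R" "vars q \<subseteq> R" "q \<noteq> 0"
    by (auto simp: rat_funs_def)
  with \<open>x \<noteq> 0\<close> have "p \<noteq> 0"
    by (auto simp: fract_collapse)
  with * show "inverse x \<in> rat_funs R"
    unfolding rat_funs_def by (intro CollectI exI[of _ q] exI[of _ p]) auto
qed

text \<open>Each further vector either lies in the span so far or raises the dimension by one. The
  list may be dependent, hence only an inequality.\<close>

lemma (in ring) dimension_Span_le:
  assumes K: "subfield K R" and "set Us \<subseteq> carrier R"
  shows "\<exists>n\<le>length Us. dimension n K (Span K Us)"
  using assms(2)
proof (induction Us)
  case Nil
  then show ?case by auto
next
  case (Cons u Us)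
  then obtain n where n: "n \<le> length Us" "dimension n K (Span K Us)" by auto
  show ?case
  proof (cases "u \<in> Span K Us")
    case True
    with Cons.prems have "Span K (u # Us) \<subseteq> Span K Us"
      using Span_base_incl[OF K, of Us] by (intro mono_Span_subset[OF K]) auto
    with Cons.prems have "Span K (u # Us) = Span K Us"
      using mono_Span[OF K, of Us u] by auto
    with n show ?thesis by (metis le_SucI length_Cons)
  next
    case False
    with n Cons.prems show ?thesis
      by (intro exI[of _ "Suc n"]) (auto intro: Suc_dim)
  qed
qed

text \<open>Although \<open>A\<close> may be infinite, a single list already spans the union: an
  independent list from \<open>A\<close> of maximal length.\<close>

lemma (in ring) dim_Union_Span_le:
  assumes K: "subfield K R" and "set Us \<subseteq> carrier R" "A \<subseteq> Span K Us"
  shows "finite_dimension K (\<Union>us\<in>lists A. Span K us)"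
    and "dim K (\<Union>us\<in>lists A. Span K us) \<le> length Us"
proof -
  obtain n where n: "n \<le> length Us" "dimension n K (Span K Us)"
    using dimension_Span_le[OF K assms(2)] by auto
  have A: "A \<subseteq> carrier R"
    using assms Span_subgroup_props(1)[OF K, of Us] by auto
  let ?P = "\<lambda>us. us \<in> lists A \<and> independent K us"
  have len: "length us \<le> n" if "?P us" for us
    using that n independent_length_le_dimension[OF K n(2), of us] assms(3) by auto
  \<comment> \<open>The maximum exists because the empty list qualifies and all lengths are at most
    \<open>n\<close>.\<close>
  obtain us where us: "?P us" and max: "\<And>vs. ?P vs \<Longrightarrow> length vs \<le> length us"
    using ex_has_greatest_nat[of ?P "[]" length "Suc n"] len by (force simp: less_Suc_eq_le)
  have "a \<in> Span K us" if "a \<in> A" for a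
  proof (rule ccontr)
    assume "a \<notin> Span K us"
    with us that A have "?P (a # us)" by (auto intro: li_Cons)
    from max[OF this] show False by simp
  qed
  then have "Span K vs \<subseteq> Span K us" if "vs \<in> lists A" for vs
    using that us A by (intro mono_Span_subset[OF K]) auto
  with us have eq: "(\<Union>us\<in>lists A. Span K us) = Span K us" by blast
  have d: "dimension (length us) K (Span K us)"
    using us by (intro dimension_independent) simp
  show "finite_dimension K (\<Union>us\<in>lists A. Span K us)"
    unfolding eq using d by (rule finite_dimensionI)
  show "dim K (\<Union>us\<in>lists A. Span K us) \<le> length Us"
    unfolding eq using dimI[OF K d] len[OF us] n(1) by (simp add: over_def)
qed

lemma dim_over_span_over_le:
  fixes K :: "'b::field set"
  assumes K: "subfield K ring_of_type_algebra"
    and "finite I"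
    and A: "\<And>x. x \<in> A \<Longrightarrow> \<exists>r. (\<forall>t\<in>I. r t \<in> K) \<and> x = (\<Sum>t\<in>I. r t * h t)"
  shows "dim_over K (span_over K A) \<le> enat (card I)"
proof -
  interpret field "ring_of_type_algebra :: 'b ring"
    by (rule field_from_type_algebra)
  \<comment> \<open>\<open>Span\<close> takes lists; enumerating \<open>I\<close> without repetition
    keeps the length equal to \<open>card I\<close>.\<close>
  obtain ts where ts: "set ts = I" "distinct ts"
    using finite_distinct_list[OF assms(2)] by auto
  let ?Us = "map h ts"
  have "A \<subseteq> Span K ?Us"
  proof
    fix x assume "x \<in> A"
    then obtain r where r: "\<And>t. t \<in> I \<Longrightarrow> r t \<in> K" "x = (\<Sum>t\<in>I. r t * h t)"
      using A by metis
    have "(\<Sum>t\<in>J. r t * h t) \<in> Span K ?Us" if "finite J" "J \<subseteq> I" for J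
      using that
    proof (induction J rule: finite_induct)
      case empty
      then show ?case using Span_subgroup_props(2)[OF K, of ?Us] by simp
    next
      case (insert t J)
      have "h t \<in> Span K ?Us"
        using Span_base_incl[OF K, of ?Us] insert.prems ts by auto
      then have "r t * h t \<in> Span K ?Us"
        using Span_smult_closed[OF K, of ?Us "r t" "h t"] r(1) insert.prems by auto
      then show ?case
        using insert Span_subgroup_props(3)[OF K, of ?Us "r t * h t"] by auto
    qed
    with r(2) assms(2) show "x \<in> Span K ?Us" by simp
  qed
  from dim_Union_Span_le[OF K _ this] have
    "ring.finite_dimension ring_of_type_algebra K (span_over K A)"
    "ring.dim ring_of_type_algebra K (span_over K A) \<le> length ts"
    by (simp_all add: span_over_def)
  moreover have "length ts = card I"
    using ts distinct_card by fastforce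
  ultimately show ?thesis
    by (simp add: dim_over_def)
qed

section \<open>Evaluation dimension of a sum of products\<close>

lemma Fract_sum: "Fract (\<Sum>i\<in>A. f i) 1 = (\<Sum>i\<in>A. Fract (f i) 1)"
proof (induction A rule: infinite_finite_induct)
  case (insert i A)
  have "Fract (f i + sum f A) 1 = Fract (f i) 1 + Fract (sum f A) 1"
    by simp
  with insert show ?case by simp
qed (simp_all add: fract_collapse)

text \<open>Substituting for the variables in \<open>U\<close> turns each \<open>g t\<close> into a
  scalar in \<open>rat_funs W\<close> and leaves \<open>h t\<close> alone, so all evaluations are
  combinations of the same \<open>card I\<close> elements.\<close>

lemma eval_dim_le_card:
  fixes f :: "'a::field mpoly"
  assumes "finite I" and f: "f = (\<Sum>t\<in>I. g t * h t)"
    and g: "\<And>t. t \<in> I \<Longrightarrow> vars (g t) \<subseteq> U \<union> W"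
    and h: "\<And>t. t \<in> I \<Longrightarrow> vars (h t) \<inter> U = {}"
  shows "eval_dim U V W f \<le> enat (card I)"
  unfolding eval_dim_def
proof (rule dim_over_span_over_le[where h = "\<lambda>t. Fract (h t) 1"])
  show "subfield (rat_funs W :: 'a mpoly fract set) ring_of_type_algebra"
    by (rule subfield_rat_funs)
  fix x assume "x \<in> {Fract (subst_on U a f) 1 |a. True}"
  then obtain a where x: "x = Fract (subst_on U a f) 1" by auto
  let ?r = "\<lambda>t. Fract (subst_on U a (g t)) 1"
  have "?r t \<in> rat_funs W" if "t \<in> I" for t
    unfolding rat_funs_def using vars_subst_on[of U a "g t"] g[OF that]
    by (intro CollectI exI[of _ "subst_on U a (g t)"] exI[of _ 1]) auto
  moreover have "subst_on U a f = (\<Sum>t\<in>I. subst_on U a (g t) * h t)"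
    unfolding f by (simp add: subst_on_sum subst_on_mult subst_on_disjoint h cong: sum.cong)
  then have "x = (\<Sum>t\<in>I. ?r t * Fract (h t) 1)"
    by (simp add: x Fract_sum)
  ultimately show "\<exists>r. (\<forall>t\<in>I. r t \<in> rat_funs W) \<and> x = (\<Sum>t\<in>I. r t * Fract (h t) 1)"
    by (intro exI[of _ ?r] conjI ballI)
qed fact

section \<open>Splitting the path sums\<close>

definition path_sum :: "('v, 'e, 'a::field) abp \<Rightarrow> 'v \<Rightarrow> 'a mpoly" where
  "path_sum B v =
     (\<Sum>p\<in>{p. pre_digraph.apath (graph B) (source B) p v}. \<Prod>e\<leftarrow>p. label B e)"

lemma is_abpD:
  assumes "is_abp n B"
  shows "fin_digraph (graph B)"
    and "v \<in> verts (graph B) \<Longrightarrow> layer B v \<le> depth B"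
    and "layer_verts B 0 = {source B}"
    and "layer_verts B (depth B) = {sink B}"
    and "e \<in> arcs (graph B) \<Longrightarrow>
      layer B (head (graph B) e) = Suc (layer B (tail (graph B) e))"
    and "e \<in> arcs (graph B) \<Longrightarrow> vars (label B e) \<subseteq> {1..n}"
  using assms by (auto simp: is_abp_def)

text \<open>Layers increase strictly along a walk, so no vertex repeats. Walks, unlike paths, can be
  extended by an edge without checking distinctness.\<close>

lemma apath_eq_awalk:
  assumes B: "is_abp n B"
  shows "pre_digraph.apath (graph B) u p v \<longleftrightarrow> pre_digraph.awalk (graph B) u p v"
proof -
  interpret fin_digraph "graph B"
    using is_abpD(1)[OF B] .
  \<comment> \<open>The lower bound on the layers strengthens the induction: it shows that the new
    start vertex does not recur.\<close>
  have "distinct (awalk_verts u p) \<and> (\<forall>x\<in>set (awalk_verts u p). layer B u \<le> layer B x)"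
    if "awalk u p v" for u
    using that
  proof (induction p arbitrary: u)
    case (Cons e p)
    then have e: "e \<in> arcs (graph B)" "u = tail (graph B) e" "awalk (head (graph B) e) p v"
      by (auto simp: awalk_Cons_iff)
    from Cons.IH[OF e(3)] is_abpD(5)[OF B e(1)] e(2) show ?case
      by force
  qed simp
  then show ?thesis
    by (auto simp: apath_def)
qed

lemma path_sum_source:
  assumes B: "is_abp n B"
  shows "path_sum B (source B) = 1"
proof -
  interpret fin_digraph "graph B"
    using is_abpD(1)[OF B] .
  have "source B \<in> verts (graph B)"
    using is_abpD(3)[OF B] by (auto simp: layer_verts_def)
  then have "{p. apath (source B) p (source B)} = {[]}"
    using apath_nonempty_ends by (auto simp: apath_Nil_iff)
  then show ?thesis
    by (simp add: path_sum_def)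
qed

text \<open>Paths to \<open>v\<close> are sorted by their last edge.\<close>

lemma path_sum_rec:
  assumes B: "is_abp n B" and v: "v \<in> verts (graph B)" "v \<noteq> source B"
  shows "path_sum B v =
    (\<Sum>e\<in>in_arcs (graph B) v. path_sum B (tail (graph B) e) * label B e)"
proof -
  interpret fin_digraph "graph B"
    using is_abpD(1)[OF B] .
  let ?P = "\<lambda>v. {p. apath (source B) p v}"
  have awalk: "apath u p w \<longleftrightarrow> awalk u p w" for u p w
    by (rule apath_eq_awalk[OF B])
  have "?P v = (\<Union>e\<in>in_arcs (graph B) v. (\<lambda>p. p @ [e]) ` ?P (tail (graph B) e))"
  proof (intro Set.set_eqI iffI)
    fix p assume "p \<in> ?P v"
    then have p: "awalk (source B) p v" by (simp add: awalk)
    with v have "p \<noteq> []" by (auto simp: awalk_Nil_iff)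
    then obtain q e where "p = q @ [e]" by (metis rev_exhaust)
    with p have "e \<in> in_arcs (graph B) v" "q \<in> ?P (tail (graph B) e)"
      by (auto simp: awalk awalk_append_iff awalk_Cons_iff awalk_Nil_iff)
    with \<open>p = q @ [e]\<close> show
      "p \<in> (\<Union>e\<in>in_arcs (graph B) v. (\<lambda>p. p @ [e]) ` ?P (tail (graph B) e))"
      by blast
  next
    fix p assume "p \<in> (\<Union>e\<in>in_arcs (graph B) v. (\<lambda>p. p @ [e]) ` ?P (tail (graph B) e))"
    then obtain q e where "p = q @ [e]" "e \<in> in_arcs (graph B) v"
      "awalk (source B) q (tail (graph B) e)"
      by (auto simp: awalk)
    moreover from this have "awalk (tail (graph B) e) [e] v"
      using arc_implies_awalk[of e] by auto
    ultimately show "p \<in> ?P v"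
      by (auto simp: awalk intro: awalk_appendI)
  qed
  then have "path_sum B v =
      (\<Sum>p\<in>(\<Union>e\<in>in_arcs (graph B) v. (\<lambda>p. p @ [e]) ` ?P (tail (graph B) e)).
        \<Prod>e\<leftarrow>p. label B e)"
    by (simp add: path_sum_def)
  also have "\<dots> = (\<Sum>e\<in>in_arcs (graph B) v.
      \<Sum>p\<in>(\<lambda>p. p @ [e]) ` ?P (tail (graph B) e). \<Prod>e\<leftarrow>p. label B e)"
    by (rule sum.UNION_disjoint) (auto intro: apaths_finite)
  also have "\<dots> = (\<Sum>e\<in>in_arcs (graph B) v. path_sum B (tail (graph B) e) * label B e)"
    by (intro sum.cong refl) (simp add: sum.reindex inj_on_def path_sum_def sum_distrib_right)
  finally show ?thesis .
qed

lemma card_layer_verts_le: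
  assumes "is_abp n B" "l \<le> depth B"
  shows "finite (layer_verts B l)" "card (layer_verts B l) \<le> width B"
proof -
  interpret fin_digraph "graph B"
    using is_abpD(1)[OF assms(1)] .
  show "finite (layer_verts B l)"
    by (simp add: layer_verts_def)
  show "card (layer_verts B l) \<le> width B"
    unfolding width_def using assms(2) by (intro Max_ge) auto
qed

text \<open>Needed to enlarge the exponent in powers of the width.\<close>

lemma width_pos:
  assumes "is_abp n B"
  shows "width B > 0"
  using card_layer_verts_le(2)[OF assms, of 0] is_abpD(3)[OF assms] by simp

text \<open>At layer \<open>l\<close> the path sums are \<open>\<Sum>\<^sub>t G\<^sub>t(v) H\<^sub>t\<close>, where the factor that depends on the end
  point \<open>v\<close> is in the variables \<open>Z b\<close> of the current phase \<open>b\<close>. The index \<open>t\<close> lists the vertices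
  visited in the layers at which the phase has changed.\<close>

definition splits_at ::
  "('v, 'e, 'a::field) abp \<Rightarrow> (bool \<Rightarrow> nat set) \<Rightarrow> nat \<Rightarrow> bool \<Rightarrow> 'v list set \<Rightarrow> bool" where
  "splits_at B Z l b I \<longleftrightarrow> finite I \<and> (\<exists>G H.
     (\<forall>v\<in>layer_verts B l. path_sum B v = (\<Sum>t\<in>I. G t v * H t)) \<and>
     (\<forall>t v. vars (G t v) \<subseteq> Z b) \<and> (\<forall>t. vars (H t) \<subseteq> Z (\<not> b)))"

lemma splits_at_source:
  assumes "is_abp n B"
  shows "splits_at B Z 0 b {[]}"
  unfolding splits_at_def using is_abpD(3)[OF assms] path_sum_source[OF assms]
  by (intro conjI exI[of _ "\<lambda>_ _. 1"] exI[of _ "\<lambda>_. 1"]) auto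

text \<open>While the phase lasts, the new labels are absorbed into the factors \<open>G\<close>;
  the factors \<open>H\<close> and the index set stay the same.\<close>

lemma splits_at_Suc:
  assumes B: "is_abp n B" and I: "splits_at B Z l b I"
    and vars: "\<And>e. e \<in> layer_arcs B (Suc l) \<Longrightarrow> vars (label B e) \<subseteq> Z b"
  shows "splits_at B Z (Suc l) b I"
proof -
  interpret fin_digraph "graph B"
    using is_abpD(1)[OF B] .
  obtain G H where
    GH: "\<And>v. v \<in> layer_verts B l \<Longrightarrow> path_sum B v = (\<Sum>t\<in>I. G t v * H t)"
      "\<And>t v. vars (G t v) \<subseteq> Z b" "\<And>t. vars (H t) \<subseteq> Z (\<not> b)" and "finite I"
    using I by (auto simp: splits_at_def)
  \<comment> \<open>For \<open>v\<close> in layer \<open>Suc l\<close> these are all incoming edges.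
    Elsewhere the set is empty, so that \<open>?G\<close> obeys the variable bound at every
    \<open>v\<close>.\<close>
  let ?E = "\<lambda>v. {e \<in> in_arcs (graph B) v. e \<in> layer_arcs B (Suc l)}"
  let ?G = "\<lambda>t v. \<Sum>e\<in>?E v. G t (tail (graph B) e) * label B e"
  have "path_sum B v = (\<Sum>t\<in>I. ?G t v * H t)" if v: "v \<in> layer_verts B (Suc l)" for v
  proof -
    have E: "in_arcs (graph B) v = ?E v"
      using v by (auto simp: layer_verts_def layer_arcs_def)
    have tail: "tail (graph B) e \<in> layer_verts B l" if "e \<in> ?E v" for e
      using that is_abpD(5)[OF B, of e] by (auto simp: layer_verts_def layer_arcs_def)
    have "source B \<in> layer_verts B 0"
      using is_abpD(3)[OF B] by auto
    then have "v \<in> verts (graph B)" "v \<noteq> source B"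
      using v by (auto simp: layer_verts_def)
    then have "path_sum B v = (\<Sum>e\<in>?E v. path_sum B (tail (graph B) e) * label B e)"
      using path_sum_rec[OF B] E by simp
    also have "\<dots> = (\<Sum>e\<in>?E v. \<Sum>t\<in>I. G t (tail (graph B) e) * label B e * H t)"
    proof (rule sum.cong[OF refl])
      fix e assume "e \<in> ?E v"
      with GH(1)[OF tail] show "path_sum B (tail (graph B) e) * label B e =
          (\<Sum>t\<in>I. G t (tail (graph B) e) * label B e * H t)"
        by (simp add: sum_distrib_left mult_ac)
    qed
    also have "\<dots> = (\<Sum>t\<in>I. \<Sum>e\<in>?E v. G t (tail (graph B) e) * label B e * H t)"
      by (rule sum.swap)
    finally show ?thesis
      by (simp add: sum_distrib_right)
  qed
  moreover have "vars (?G t v) \<subseteq> Z b" for t v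
    using GH(2) vars by (intro vars_sum_le vars_mult_le) auto
  ultimately show ?thesis
    unfolding splits_at_def using GH(3) \<open>finite I\<close>
    by (intro conjI exI[of _ ?G] exI[of _ H]) auto
qed

text \<open>Once the vertex \<open>u\<close> of layer \<open>l\<close> is fixed in the index,
  \<open>G t u\<close> no longer depends on the end point, and the two factors can exchange
  roles.\<close>

lemma splits_at_switch:
  assumes fin: "finite (layer_verts B l)" and I: "splits_at B Z l b I"
  shows "\<exists>J. splits_at B Z l (\<not> b) J \<and> card J \<le> card (layer_verts B l) * card I"
proof -
  let ?V = "layer_verts B l"
  let ?cons = "\<lambda>(u, t). u # t"
  obtain G H where
    GH: "\<And>v. v \<in> ?V \<Longrightarrow> path_sum B v = (\<Sum>t\<in>I. G t v * H t)"
      "\<And>t v. vars (G t v) \<subseteq> Z b" "\<And>t. vars (H t) \<subseteq> Z (\<not> b)" and "finite I"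
    using I by (auto simp: splits_at_def)
  let ?J = "?cons ` (?V \<times> I)"
  \<comment> \<open>The vertex stored at the head of the index selects \<open>v\<close>; the old
    \<open>H\<close> becomes the factor that later layers extend.\<close>
  let ?G = "\<lambda>t v. if hd t = v then H (tl t) else 0"
  let ?H = "\<lambda>t. G (tl t) (hd t)"
  have "path_sum B v = (\<Sum>t\<in>?J. ?G t v * ?H t)" if v: "v \<in> ?V" for v
  proof -
    have "(\<Sum>t\<in>?J. ?G t v * ?H t) =
        (\<Sum>(u, t)\<in>?V \<times> I. (if u = v then H t else 0) * G t u)"
      by (subst sum.reindex) (auto simp: inj_on_def intro!: sum.cong)
    also have "\<dots> = (\<Sum>u\<in>?V. \<Sum>t\<in>I. (if u = v then H t else 0) * G t u)"
      by (rule sum.cartesian_product[symmetric])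
    also have "\<dots> = (\<Sum>u\<in>?V. if u = v then (\<Sum>t\<in>I. G t v * H t) else 0)"
      by (intro sum.cong) (auto simp: mult.commute)
    also have "\<dots> = path_sum B v"
      using v fin GH(1) by simp
    finally show ?thesis by simp
  qed
  then have "splits_at B Z l (\<not> b) ?J"
    unfolding splits_at_def using GH(2,3) \<open>finite I\<close> fin
    by (intro conjI exI[of _ ?G] exI[of _ ?H]) auto
  moreover have "card ?J \<le> card ?V * card I"
    using card_image_le[of "?V \<times> I" ?cons] fin \<open>finite I\<close> by (simp add: card_cartesian_product)
  ultimately show ?thesis by blast
qed

text \<open>Only phase changes enlarge the index set, each by at most a factor
  \<open>width B\<close>. The value \<open>c 0\<close> is the phase assigned to the source.\<close>

lemma splits_at_layer:
  assumes B: "is_abp n B"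
    and vars: "\<And>l e. l \<in> {1..depth B} \<Longrightarrow> e \<in> layer_arcs B l \<Longrightarrow>
      vars (label B e) \<subseteq> Z (c l)"
  shows "l \<le> depth B \<Longrightarrow>
    \<exists>I. splits_at B Z l (c l) I \<and> card I \<le> width B ^ card {j\<in>{1..l}. c j \<noteq> c (j - 1)}"
proof (induction l)
  case 0
  then show ?case
    using splits_at_source[OF B] by (intro exI[of _ "{[]}"]) simp
next
  case (Suc l)
  let ?s = "\<lambda>l. {j\<in>{1..l}. c j \<noteq> c (j - 1)}"
  from Suc obtain I where I: "splits_at B Z l (c l) I" "card I \<le> width B ^ card (?s l)"
    by auto
  have vars': "vars (label B e) \<subseteq> Z (c (Suc l))" if "e \<in> layer_arcs B (Suc l)" for e
    using that Suc.prems by (intro vars) auto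
  show ?case
  proof (cases "c (Suc l) = c l")
    case True
    then have "?s (Suc l) = ?s l"
      by (auto simp: le_Suc_eq)
    with True I splits_at_Suc[OF B I(1)] vars' show ?thesis by auto
  next
    case False
    then have "?s (Suc l) = insert (Suc l) (?s l)"
      by (auto simp: le_Suc_eq)
    then have s: "card (?s (Suc l)) = Suc (card (?s l))"
      by simp
    have l: "l \<le> depth B" using Suc.prems by simp
    \<comment> \<open>The roles are exchanged at the vertices of layer \<open>l\<close>, since the
      edges into layer \<open>Suc l\<close> already belong to the new phase.\<close>
    from splits_at_switch[OF card_layer_verts_le(1)[OF B l] I(1)] obtain J where
      J: "splits_at B Z l (\<not> c l) J" "card J \<le> card (layer_verts B l) * card I" by auto
    have "card J \<le> width B ^ card (?s (Suc l))"
      using J(2) mult_le_mono[OF card_layer_verts_le(2)[OF B l] I(2)]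
      unfolding s power_Suc by linarith
    moreover have "splits_at B Z (Suc l) (c (Suc l)) J"
      using splits_at_Suc[OF B, of Z l "c (Suc l)" J] J(1) False vars' by auto
    ultimately show ?thesis by auto
  qed
qed

text \<open>The last layer consists of the sink alone, so the split of its path sum writes the whole
  polynomial as a sum of products.\<close>

lemma eval_dim_abp_le:
  fixes B :: "('v, 'e, 'a::field) abp"
  assumes B: "is_abp n B" and U: "U \<inter> V = {}" "U \<inter> W = {}" "{1..n} \<subseteq> U \<union> V \<union> W"
    and vars: "\<And>l e. l \<in> {1..depth B} \<Longrightarrow> e \<in> layer_arcs B l \<Longrightarrow>
      vars (label B e) \<inter> (if c l then V else U) = {}"
    and m: "card {j\<in>{1..depth B}. c j \<noteq> c (j - 1)} \<le> m"
  shows "eval_dim U V W (abp_poly B) \<le> enat (width B ^ m)"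
proof -
  define Z where "Z b = (if b then U \<union> W else V \<union> W)" for b
  have vars': "vars (label B e) \<subseteq> Z (c l)" if "l \<in> {1..depth B}" "e \<in> layer_arcs B l" for l e
    using vars[OF that] is_abpD(6)[OF B, of e] that U(3)
    by (cases "c l") (auto simp: Z_def layer_arcs_def)
  define b where "b = c (depth B)"
  obtain I where I: "splits_at B Z (depth B) b I"
    "card I \<le> width B ^ card {j\<in>{1..depth B}. c j \<noteq> c (j - 1)}"
    using splits_at_layer[where Z = Z and c = c, OF B vars' order_refl] by (auto simp: b_def)
  then obtain G H where "finite I" and
    GH: "abp_poly B = (\<Sum>t\<in>I. G t * H t)" "\<And>t. vars (G t) \<subseteq> Z b" "\<And>t. vars (H t) \<subseteq> Z (\<not> b)"
    using is_abpD(4)[OF B] unfolding splits_at_def abp_poly_def path_sum_def by auto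
  have "eval_dim U V W (abp_poly B) \<le> enat (card I)"
  \<comment> \<open>The phase at the sink decides which of \<open>G\<close> and \<open>H\<close> is
    the factor in the variables of \<open>U\<close> and \<open>W\<close>.\<close>
  proof (cases b)
    case True
    have "vars (H t) \<inter> U = {}" for t
      using GH(3)[of t] True U(1,2) by (auto simp: Z_def)
    with GH True \<open>finite I\<close> show ?thesis
      by (intro eval_dim_le_card) (simp_all add: Z_def)
  next
    case False
    have "vars (G t) \<inter> U = {}" for t
      using GH(2)[of t] False U(1,2) by (auto simp: Z_def)
    moreover have "abp_poly B = (\<Sum>t\<in>I. H t * G t)"
      by (simp only: GH(1) mult.commute)
    ultimately show ?thesis
      using GH(3) False \<open>finite I\<close> by (intro eval_dim_le_card) (simp_all add: Z_def)
  qed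
  also have "card I \<le> width B ^ m"
    using I(2) power_increasing[OF m, of "width B"] width_pos[OF B] by linarith
  finally show ?thesis by simp
qed

section \<open>The partition of the variables\<close>

text \<open>By monotonicity the indices with a given block value form an interval, so each element
  of \<open>T\<close> is entered at most once and left at most once.\<close>

lemma card_switches_le:
  fixes block :: "nat \<Rightarrow> nat"
  assumes "mono block" "finite T"
  shows "card {j\<in>{1..l}. (block j \<in> T) \<noteq> (block (j - 1) \<in> T)} \<le> 2 * card T"
proof -
  let ?In = "{j\<in>{1..l}. block j \<in> T \<and> block (j - 1) \<notin> T}"
  let ?Out = "{j\<in>{1..l}. block j \<notin> T \<and> block (j - 1) \<in> T}"
  have mono: "block i \<le> block (j - 1)" "block (i - 1) \<le> block (j - 1)" "block i \<le> block j"
    if "i < j" for i j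
    using that assms(1) by (auto simp: mono_def)
  have "inj_on block ?In"
  proof (rule linorder_inj_onI')
    fix i j assume ij: "i \<in> ?In" "j \<in> ?In" "i < j"
    with mono[of i j] mono[of "j - 1" j] have "block i \<le> block (j - 1)" "block (j - 1) \<le> block j"
      by auto
    with ij show "block i \<noteq> block j" by auto
  qed
  then have In: "card ?In \<le> card T"
    using assms(2) by (intro card_inj_on_le) auto
  have "inj_on (\<lambda>j. block (j - 1)) ?Out"
  proof (rule linorder_inj_onI')
    fix i j assume ij: "i \<in> ?Out" "j \<in> ?Out" "i < j"
    with mono[of i j] mono[of "i - 1" i] have "block i \<le> block (j - 1)" "block (i - 1) \<le> block i"
      by auto
    with ij show "block (i - 1) \<noteq> block (j - 1)" by auto
  qed
  then have Out: "card ?Out \<le> card T"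
    using assms(2) by (intro card_inj_on_le) auto
  have "{j\<in>{1..l}. (block j \<in> T) \<noteq> (block (j - 1) \<in> T)} = ?In \<union> ?Out"
    by auto
  then show ?thesis
    using card_Un_le[of ?In ?Out] In Out by simp
qed

text \<open>Every layer is its own block here. A layer that reads variable 1 reads nothing else,
  since it reads at most one variable.\<close>

lemma partition_single_variable:
  fixes reads :: "nat \<Rightarrow> nat set"
  assumes "n > 0"
    and sub: "\<And>l. l \<in> {1..L} \<Longrightarrow> reads l \<subseteq> {1..n}"
    and one: "\<And>l. l \<in> {1..L} \<Longrightarrow> \<exists>i. reads l \<subseteq> {i}"
    and k: "\<And>i. card {l\<in>{1..L}. i \<in> reads l} \<le> k"
  obtains T and block :: "nat \<Rightarrow> nat" where "finite T" "card T \<le> k" "mono block"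
    "\<And>l. l \<in> {1..L} \<Longrightarrow> if block l \<in> T then reads l \<subseteq> {1} else reads l \<subseteq> {2..n}"
proof -
  let ?T = "{l\<in>{1..L}. 1 \<in> reads l}"
  have *: "if l \<in> ?T then reads l \<subseteq> {1} else reads l \<subseteq> {2..n}" if l: "l \<in> {1..L}" for l
  proof (cases "1 \<in> reads l")
    case True
    with one[OF l] l show ?thesis by auto
  next
    case False
    have "i \<in> {2..n}" if "i \<in> reads l" for i
    proof -
      have "i \<in> {1..n}" "i \<noteq> 1" using that sub[OF l] False by auto
      then show ?thesis by auto
    qed
    with False show ?thesis by auto
  qed
  show thesis
  proof (rule that)
    show "finite ?T" "card ?T \<le> k"
      using k by simp_all
    show "mono (\<lambda>l :: nat. l)"
      by (simp add: mono_def)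
  qed (rule *)
qed

text \<open>If all fibres were below average, they could not add up to \<open>A\<close>. The product
  form avoids division.\<close>

lemma pigeonhole_finite:
  assumes "finite A" "finite S" "f ` A \<subseteq> S" "S \<noteq> {}"
  shows "\<exists>y\<in>S. card A \<le> card {x\<in>A. f x = y} * card S"
proof (rule ccontr)
  assume "\<not> ?thesis"
  then have less: "card {x\<in>A. f x = y} * card S < card A" if "y \<in> S" for y
    using that by force
  have "card A = (\<Sum>y\<in>S. card {x\<in>A. f x = y})"
    using assms by (subst card_UN_disjoint[symmetric]) (auto intro!: arg_cong[where f = card])
  then have "card A * card S = (\<Sum>y\<in>S. card {x\<in>A. f x = y} * card S)"
    by (simp add: sum_distrib_right)
  also have "\<dots> < (\<Sum>y\<in>S. card A)"
    using assms less by (intro sum_strict_mono) auto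
  finally show False by simp
qed

text \<open>There are \<open>R\<close> blocks of at most \<open>s\<close> reading layers each;
  \<open>n * k < s * R\<close> makes them suffice. \<open>P\<close> collects variables read only in
  the blocks of a common set \<open>T\<close>, and \<open>Q\<close> everything read there.\<close>

lemma partition_blocks:
  fixes reads :: "nat \<Rightarrow> nat set"
  assumes "s > 0" "k \<le> R" "n * k < s * R" "R > 0"
    and sub: "\<And>l. l \<in> {1..L} \<Longrightarrow> reads l \<subseteq> {1..n}"
    and one: "\<And>l. l \<in> {1..L} \<Longrightarrow> \<exists>i. reads l \<subseteq> {i}"
    and k: "\<And>i. card {l\<in>{1..L}. i \<in> reads l} \<le> k"
  obtains T P Q and block :: "nat \<Rightarrow> nat" where "finite T" "card T \<le> k" "mono block"
    "P \<subseteq> {1..n}" "n \<le> card P * R ^ k" "Q \<subseteq> {1..n}" "card Q \<le> k * s"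
    "\<And>l. l \<in> {1..L} \<Longrightarrow> if block l \<in> T then reads l \<subseteq> Q else reads l \<inter> P = {}"
proof -
  \<comment> \<open>Layers that read nothing may be arbitrarily many, so blocks are measured by
    reading layers, of which there are at most \<open>n * k\<close>.\<close>
  define N where "N l = card {j\<in>{1..l}. reads j \<noteq> {}}" for l
  define block where "block l = N l div s" for l
  define B where "B i = block ` {l\<in>{1..L}. i \<in> reads l}" for i
  have N_mono: "N i \<le> N j" if "i \<le> j" for i j
    unfolding N_def using that by (intro card_mono) auto
  then have mono: "mono block"
    by (auto simp: block_def mono_def div_le_mono)
  have N_less: "N i < N j" if "i < j" "reads j \<noteq> {}" for i j
  proof -
    have "j \<in> {l\<in>{1..j}. reads l \<noteq> {}}" "j \<notin> {l\<in>{1..i}. reads l \<noteq> {}}"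
      using that by auto
    moreover have "{l\<in>{1..i}. reads l \<noteq> {}} \<subseteq> {l\<in>{1..j}. reads l \<noteq> {}}"
      using that by auto
    ultimately show ?thesis
      unfolding N_def by (intro psubset_card_mono psubsetI) auto
  qed

  have "N L \<le> n * k"
  proof -
    have "{j\<in>{1..L}. reads j \<noteq> {}} \<subseteq> (\<Union>i\<in>{1..n}. {l\<in>{1..L}. i \<in> reads l})"
      using sub by blast
    then have "N L \<le> card (\<Union>i\<in>{1..n}. {l\<in>{1..L}. i \<in> reads l})"
      unfolding N_def by (intro card_mono) auto
    also have "\<dots> \<le> (\<Sum>i\<in>{1..n}. card {l\<in>{1..L}. i \<in> reads l})"
      by (rule card_UN_le) simp
    also have "\<dots> \<le> (\<Sum>i\<in>{1..n}. k)"
      using k by (intro sum_mono) auto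
    finally show ?thesis by simp
  qed
  have block_less: "block l < R" if "l \<le> L" for l
    using N_mono[OF that] \<open>N L \<le> n * k\<close> assms(3) \<open>s > 0\<close>
    by (simp add: block_def less_mult_imp_div_less mult.commute)

  \<comment> \<open>Padding to exactly \<open>k\<close> blocks leaves at most \<open>R ^ k\<close>
    candidate sets for the pigeonhole argument.\<close>
  have "\<exists>C. B i \<subseteq> C \<and> C \<subseteq> {..<R} \<and> card C = k" for i
  proof -
    have "card (B i) \<le> k"
      unfolding B_def using card_image_le[of "{l\<in>{1..L}. i \<in> reads l}" block] k[of i] by simp
    moreover have "B i \<subseteq> {..<R}"
      using block_less by (auto simp: B_def)
    ultimately show ?thesis
      using exists_subset_between[of "B i" k "{..<R}"] assms(2) by auto
  qed
  then obtain C where C: "\<And>i. B i \<subseteq> C i" "\<And>i. C i \<subseteq> {..<R}" "\<And>i. card (C i) = k"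
    by metis
  let ?S = "{T. T \<subseteq> {..<R} \<and> card T = k}"
  have fin: "finite ?S"
    by (rule finite_subset[of _ "Pow {..<R}"]) auto
  have "card ?S = R choose k"
    using n_subsets[of "{..<R}" k] by simp
  also have "\<dots> \<le> R ^ k"
    using assms(2) by (rule binomial_le_pow)
  finally have card_S: "card ?S \<le> R ^ k" .
  obtain T where T: "T \<in> ?S" "n \<le> card {i\<in>{1..n}. C i = T} * card ?S"
    using pigeonhole_finite[of "{1..n}" ?S C] fin C by fastforce
  define P where "P = {i\<in>{1..n}. C i = T}"
  define Q where "Q = (\<Union>l\<in>{l\<in>{1..L}. block l \<in> T}. reads l)"
  have "n \<le> card P * R ^ k"
    using T(2) card_S mult_le_mono2[OF card_S] unfolding P_def by (meson order_trans)
  moreover have "finite T"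
    using T(1) finite_subset by auto
  moreover have "card Q \<le> k * s"
  proof -
    let ?J = "{l\<in>{1..L}. block l \<in> T \<and> reads l \<noteq> {}}"
    have Q: "Q = (\<Union>l\<in>?J. reads l)"
      by (auto simp: Q_def)
    have "card (reads l) \<le> 1" if "l \<in> {1..L}" for l
    proof -
      from one[OF that] obtain i where "reads l \<subseteq> {i}" by auto
      then show ?thesis using card_mono[of "{i}" "reads l"] by simp
    qed
    then have "(\<Sum>l\<in>?J. card (reads l)) \<le> (\<Sum>l\<in>?J. 1)"
      by (intro sum_mono) auto
    then have "card Q \<le> card ?J"
      unfolding Q using card_UN_le[of ?J reads] by simp
    \<comment> \<open>\<open>N\<close> grows strictly at each reading layer and maps the layers of
      block \<open>t\<close> into an interval of length \<open>s\<close>.\<close>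
    also have "\<dots> \<le> card (N ` ?J)"
    proof -
      have "inj_on N ?J"
        using N_less by (intro linorder_inj_onI') (force dest: less_imp_neq)
      then show ?thesis by (simp add: card_image)
    qed
    also have "\<dots> \<le> card (\<Union>t\<in>T. {t * s..<t * s + s})"
    proof (intro card_mono)
      show "finite (\<Union>t\<in>T. {t * s..<t * s + s})"
        using \<open>finite T\<close> by simp
      have "m \<in> {m div s * s..<m div s * s + s}" for m
        using dividend_less_div_times[OF \<open>s > 0\<close>, of m] by simp
      then show "N ` ?J \<subseteq> (\<Union>t\<in>T. {t * s..<t * s + s})"
        by (fastforce simp: block_def)
    qed
    also have "\<dots> \<le> (\<Sum>t\<in>T. card {t * s..<t * s + s})"
      using \<open>finite T\<close> by (rule card_UN_le)
    also have "\<dots> = k * s"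
      using T(1) by simp
    finally show ?thesis .
  qed
  moreover have "if block l \<in> T then reads l \<subseteq> Q else reads l \<inter> P = {}" if "l \<in> {1..L}" for l
  proof (cases "block l \<in> T")
    case True
    with that show ?thesis by (auto simp: Q_def)
  next
    case False
    have "i \<notin> P" if "i \<in> reads l" for i
    proof
      assume "i \<in> P"
      then have "B i \<subseteq> T" using C(1)[of i] by (simp add: P_def)
      then show False using False that \<open>l \<in> {1..L}\<close> by (auto simp: B_def)
    qed
    with False show ?thesis by auto
  qed
  moreover have "Q \<subseteq> {1..n}"
    using sub by (auto simp: Q_def)
  moreover have "P \<subseteq> {1..n}"
    by (auto simp: P_def)
  moreover have "card T \<le> k"
    using T(1) by simp
  ultimately show thesis
    using mono by (intro that[of T block P Q])
qed

lemma eval_dim_blocks_le: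
  fixes B :: "('v, 'e, 'a::field) abp" and block :: "nat \<Rightarrow> nat"
  assumes B: "is_abp n B"
    and UVW: "U \<union> V \<union> W = {1..n}" "U \<inter> V = {}" "U \<inter> W = {}"
    and T: "finite T" "card T \<le> k" and "mono block"
    and vars: "\<And>l e. l \<in> {1..depth B} \<Longrightarrow> e \<in> layer_arcs B l \<Longrightarrow>
      vars (label B e) \<inter> (if block l \<in> T then V else U) = {}"
  shows "eval_dim U V W (abp_poly B) \<le> enat (width B ^ (2 * k))"
proof (rule eval_dim_abp_le[where c = "\<lambda>l. block l \<in> T", OF B UVW(2,3) _ vars])
  show "card {j\<in>{1..depth B}. (block j \<in> T) \<noteq> (block (j - 1) \<in> T)} \<le> 2 * k"
    using card_switches_le[OF \<open>mono block\<close> T(1), of "depth B"] T(2) by linarith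
qed (use UVW in auto)

text \<open>The base \<open>max 2 k\<close> keeps the bound meaningful for \<open>k = 1\<close>,
  where a power of \<open>k\<close> would demand \<open>n\<close> variables in both \<open>U\<close>
  and \<open>V\<close>. For \<open>n = 1\<close> the two sets could not both be nonempty.\<close>

theorem theorem4p2:
  fixes f :: "'a::field mpoly"
    and B :: "('v, 'e, 'a) abp"
    and n k w :: nat
  assumes "n \<noteq> 1" and "k \<ge> 1"
    and "vars f \<subseteq> {1..n}"
    and "is_abp n B" and "oblivious B" and "read_at_most k B" and "width B = w"
    and "abp_poly B = f"
  shows "\<exists>U V W. U \<union> V \<union> W = {1..n} \<and> U \<inter> V = {} \<and> U \<inter> W = {} \<and> V \<inter> W = {} \<and>
    real (card U) \<ge> real n / real (max 2 k) ^ (100 * k) \<and>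
    real (card V) \<ge> real n / real (max 2 k) ^ (100 * k) \<and>
    real (card W) \<le> real n / 10 \<and>
    eval_dim U V W f \<le> enat (w ^ (2 * k))"
proof -
  let ?L = "depth B"
  define reads where "reads l = (\<Union>e\<in>layer_arcs B l. vars (label B e))" for l
  have sub: "reads l \<subseteq> {1..n}" if "l \<in> {1..?L}" for l
    using is_abpD(6)[OF \<open>is_abp n B\<close>] by (force simp: reads_def layer_arcs_def)
  have one: "\<exists>i. reads l \<subseteq> {i}" if "l \<in> {1..?L}" for l
    using \<open>oblivious B\<close> that unfolding oblivious_def reads_def by blast
  have k: "card {l\<in>{1..?L}. i \<in> reads l} \<le> k" for i
    using \<open>read_at_most k B\<close> by (simp add: read_at_most_def reads_def)
  have eval_dim: "eval_dim U V W f \<le> enat (w ^ (2 * k))"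
    if "U \<union> V \<union> W = {1..n}" "U \<inter> V = {}" "U \<inter> W = {}"
      "finite T" "card T \<le> k" "mono block"
      "\<And>l. l \<in> {1..?L} \<Longrightarrow> reads l \<inter> (if block l \<in> T then V else U) = {}"
    for U V W and T :: "nat set" and block :: "nat \<Rightarrow> nat"
    using eval_dim_blocks_le[OF \<open>is_abp n B\<close> that(1-6)] that(7) assms(7,8)
    unfolding reads_def by blast
  let ?m = "max 2 k"
  let ?M = "?m ^ (100 * k)"
  have "10 * k \<le> 2 ^ 4 * ?m"
    by simp
  also have "\<dots> \<le> ?m ^ 4 * ?m"
    by (intro mult_le_mono1 power_mono) auto
  also have "\<dots> = ?m ^ 5"
    by (simp add: power_Suc2[symmetric] del: power_Suc2)
  also have "\<dots> \<le> ?M"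
    using \<open>k \<ge> 1\<close> by (intro power_increasing) auto
  finally have M: "10 * k \<le> ?M" .
  consider "n = 0" | "n \<ge> 2" "n < 10 * k" | "n \<ge> 10 * k"
    using \<open>n \<noteq> 1\<close> by linarith
  then show ?thesis
  proof cases
    case 1
    then show ?thesis
      using eval_dim[of "{}" "{}" "{}" "{}" "\<lambda>_. 0"] by (intro exI[of _ "{}"]) (auto simp: mono_def)
  next
    case 2
    \<comment> \<open>Since \<open>n < 10 * k \<le> ?M\<close>, one variable in each of
      \<open>U\<close> and \<open>V\<close> is enough.\<close>
    then have small: "real n / real ?M \<le> 1"
      using M by simp
    obtain T block where T: "finite T" "card T \<le> k" "mono (block :: nat \<Rightarrow> nat)"
      "\<And>l. l \<in> {1..?L} \<Longrightarrow> if block l \<in> T then reads l \<subseteq> {1} else reads l \<subseteq> {2..n}"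
      by (rule partition_single_variable[of n ?L reads k]) (use sub one k 2(1) in auto)
    have un: "{1} \<union> {2..n} \<union> {} = {1..n}"
      using 2(1) by auto
    have dim: "eval_dim {1} {2..n} {} f \<le> enat (w ^ (2 * k))"
    proof (rule eval_dim[OF un _ _ T(1-3)])
      fix l assume "l \<in> {1..?L}"
      from T(4)[OF this] show "reads l \<inter> (if block l \<in> T then {2..n} else {1}) = {}"
        by (auto split: if_splits)
    qed auto
    have "real (card {2..n}) \<ge> 1"
      using 2(1) by simp
    then show ?thesis
      using un small dim
      by (intro exI[of _ "{1}"] exI[of _ "{2..n}"] exI[of _ "{}"] conjI) auto
  next
    case 3
    let ?R = "20 * k\<^sup>2"
    \<comment> \<open>\<open>k * s \<le> n / 10\<close> will bound \<open>W\<close>. Rounding down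
      costs less than a factor 2, so \<open>n < 20 * k * s\<close> and \<open>20 * k^2\<close>
      blocks suffice.\<close>
    define s where "s = n div (10 * k)"
    have "s > 0"
      using 3 \<open>k \<ge> 1\<close> by (simp add: s_def div_greater_zero_iff)
    have ks: "10 * (k * s) \<le> n"
      using times_div_less_eq_dividend[of "10 * k" n] by (simp add: s_def mult.assoc)
    have "n < 10 * k + 10 * k * s"
      using dividend_less_times_div[of "10 * k" n] \<open>k \<ge> 1\<close> by (simp add: s_def)
    also have "\<dots> \<le> 20 * k * s"
      using \<open>s > 0\<close> by simp
    finally have nk: "n * k < s * ?R"
      using \<open>k \<ge> 1\<close> by (simp add: power2_eq_square ac_simps)
    have R: "k \<le> ?R" "?R > 0"
      using \<open>k \<ge> 1\<close> by (simp_all add: power2_eq_square)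
    obtain T P Q block where T: "finite T" "card T \<le> k" "mono (block :: nat \<Rightarrow> nat)"
      and PQ: "P \<subseteq> {1..n}" "n \<le> card P * ?R ^ k" "Q \<subseteq> {1..n}" "card Q \<le> k * s"
      and reads: "\<And>l. l \<in> {1..?L} \<Longrightarrow>
        if block l \<in> T then reads l \<subseteq> Q else reads l \<inter> P = {}"
      by (rule partition_blocks[OF \<open>s > 0\<close> R(1) nk R(2), of ?L reads]) (use sub one k in auto)
    have "?R \<le> 2 ^ 5 * ?m\<^sup>2"
      by (intro mult_le_mono power_mono) auto
    also have "\<dots> \<le> ?m ^ 5 * ?m\<^sup>2"
      by (intro mult_le_mono1 power_mono) auto
    also have "\<dots> \<le> ?m ^ 100"
      unfolding power_add[symmetric] by (intro power_increasing) auto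
    finally have "?R ^ k \<le> ?M"
      unfolding power_mult by (intro power_mono) auto
    then have "n \<le> card P * ?M"
      using PQ(2) by (meson mult_le_mono2 order_trans)
    then have "real n \<le> real (card P) * real ?M"
      by (metis of_nat_le_iff of_nat_mult)
    then have nM: "real n / real ?M \<le> real (card P)"
      by (simp add: divide_le_eq)
    \<comment> \<open>\<open>U\<close> takes only as many elements of \<open>P\<close> as required,
      because \<open>P\<close> could be almost all of \<open>{1..n}\<close> and leave too little for
      \<open>V\<close>.\<close>
    define q where "q = nat \<lceil>real n / real ?M\<rceil>"
    have q: "real n / real ?M \<le> real q" "real q \<le> real n / real ?M + 1"
      using divide_nonneg_nonneg[of "real n" "real ?M"] unfolding q_def by linarith+
    have "q \<le> card P"
      using nM unfolding q_def by (simp add: ceiling_le_iff nat_le_iff)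
    then obtain U where U: "U \<subseteq> P" "card U = q"
      by (meson obtain_subset_with_card_n)
    let ?V = "{1..n} - (U \<union> Q)"
    let ?W = "Q - U"
    have "card ?W \<le> k * s"
      using card_mono[of Q ?W] finite_subset[OF PQ(3)] PQ(4) by simp
    then have W: "real (card ?W) \<le> real n / 10"
      using ks by simp
    have "card (U \<union> Q) \<le> q + k * s"
      using card_Un_le[of U Q] U(2) PQ(4) by simp
    then have "n \<le> card ?V + (q + k * s)"
      using diff_card_le_card_Diff[of "U \<union> Q" "{1..n}"] U(1) PQ(1,3)
      by (simp add: finite_subset[of _ "{1..n}"])
    then have "real n \<le> real (card ?V) + real q + real n / 10"
      using ks by linarith
    moreover have "10 \<le> ?M"
      using M \<open>k \<ge> 1\<close> by linarith
    then have "10 \<le> real ?M"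
      using of_nat_mono[of 10 ?M] by simp
    then have "real n / real ?M \<le> real n / 10"
      by (intro divide_left_mono) auto
    \<comment> \<open>At most \<open>n / 10 + 1\<close> variables go to \<open>U\<close> and
      \<open>n / 10\<close> to \<open>Q\<close>; as \<open>n \<ge> 10\<close>, at least
      \<open>n / 10\<close> remain.\<close>
    ultimately have V: "real n / real ?M \<le> real (card ?V)"
      using q(2) 3 \<open>k \<ge> 1\<close> by linarith
    have un: "U \<union> ?V \<union> ?W = {1..n}"
      using U(1) PQ(1,3) by auto
    have dim: "eval_dim U ?V ?W f \<le> enat (w ^ (2 * k))"
    proof (rule eval_dim[OF un _ _ T])
      fix l assume "l \<in> {1..?L}"
      from reads[OF this] show "reads l \<inter> (if block l \<in> T then ?V else U) = {}"
        using U(1) by (auto split: if_splits)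
    qed auto
    show ?thesis
    proof (intro exI conjI)
      show "real n / real ?m ^ (100 * k) \<le> real (card U)"
        using q(1) U(2) by simp
      show "real n / real ?m ^ (100 * k) \<le> real (card ?V)"
        using V by simp
      show "U \<inter> ?V = {}" "U \<inter> ?W = {}" "?V \<inter> ?W = {}"
        by auto
    qed (fact un W dim)+
  qed
qed

end
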